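(* Each component of a mixed Pham-Brieskorn surface germ $(X_{\mathbf{a},\mathbf{b}},0)$ of type (1), (2), (4), or (5) (types as defined in the context) is inner bi-Lipschitz equivalent to the germ at the origin of the metric cone $H_1=\{(x,y,z)\in\mathbb{R}^3: x^2+y^2=z^2,\ z\ge 0\}$.
   Context: For integers $0\le a_1\le a_2$, $a_2\ge 1$, $b_1,b_2\ge 0$ (with $b_1\ge 1$ if $a_1=0$), put $f_{\mathbf{a},\mathbf{b}}(z_1,z_2)=z_1^{a_1+b_1}\overline{z}_1^{\,b_1}+z_2^{a_2+b_2}\overline{z}_2^{\,b_2}$; the mixed Pham-Brieskorn surface is the germ at $0$ of $X_{\mathbf{a},\mathbf{b}}=f_{\mathbf{a},\mathbf{b}}^{-1}(0)\subset\mathbb{C}^2=\mathbb{R}^4$, and $\mu_{\mathbf{a},\mathbf{b}}=\frac{a_2+2b_2}{a_1+2b_1}$. Types: (1) $a_1\ge1$, $\mu_{\mathbf{a},\mathbf{b}}>1$; (2) $a_1\ge1$, $\mu_{\mathbf{a},\mathbf{b}}=1$; (3) $a_1=0$, $\mu_{\mathbf{a},\mathbf{b}}>1$; (4) $a_1=0$, $\mu_{\mathbf{a},\mathbf{b}}<1$; (5) $a_1=0$, $\mu_{\mathbf{a},\mathbf{b}}=1$. Standing assumptions: the cases $(a_1,b_1)=(1,0)$ and $(a_2,b_2)=(1,0)$ are excluded, and for surfaces of type (1) one assumes $\gcd(a_1,a_2)=1$. A component of $X_{\mathbf{a},\mathbf{b}}$ is a connected component of $X_{\mathbf{a},\mathbf{b}}\setminus\{0\}$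 (as a germ) together with the origin. The inner metric $d_i(x,y)$ on a set $X\subset\mathbb{R}^m$ is the infimum of lengths of rectifiable arcs in $X$ joining $x$ and $y$. Two germs $(X,0),(Y,0)$ are inner bi-Lipschitz equivalent if there is a germ of homeomorphism $(X,0)\to(Y,0)$ that is bi-Lipschitz for the inner metrics. *)

theory Defs
  imports "HOL-Analysis.Analysis"
begin

section \<open>Inner metric and inner bi-Lipschitz equivalence of germs\<close>

text \<open>Polygonal variation of a curve parametrised by the unit interval; it is \<^term>\<open>top\<close>
  exactly when the curve is not rectifiable.\<close>

definition curve_length :: "(real \<Rightarrow> 'a::metric_space) \<Rightarrow> ennreal" where
  "curve_length g =
     (SUP (t, n) \<in> {(t :: nat \<Rightarrow> real, n). (\<forall>i\<le>n. t i \<in> {0..1}) \<and> mono_on {..n} t}.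
        \<Sum>i<n. ennreal (dist (g (t i)) (g (t (Suc i)))))"

definition rectifiable :: "(real \<Rightarrow> 'a::metric_space) \<Rightarrow> bool" where
  "rectifiable g \<longleftrightarrow> path g \<and> curve_length g < top"

text \<open>Arcs are continuous, not necessarily injective curves, so that the constant curve gives
  \<open>inner_dist X x x = 0\<close>. The distance of points of \<open>X\<close> that no rectifiable curve in \<open>X\<close> joins
  is \<^term>\<open>top\<close>.\<close>

definition inner_dist :: "'a::metric_space set \<Rightarrow> 'a \<Rightarrow> 'a \<Rightarrow> ennreal" where
  "inner_dist X x y =
     (INF g \<in> {g. rectifiable g \<and> path_image g \<subseteq> X \<and> pathstart g = x \<and> pathfinish g = y}.
        curve_length g)"

definition inner_bilipschitz_on ::
    "'a::metric_space set \<Rightarrow> 'b::metric_space set \<Rightarrow> ('a \<Rightarrow> 'b) \<Rightarrow> bool" where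
  "inner_bilipschitz_on U V h \<longleftrightarrow>
     (\<exists>K\<ge>1. \<forall>x\<in>U. \<forall>y\<in>U.
        inner_dist V (h x) (h y) \<le> ennreal K * inner_dist U x y \<and>
        inner_dist U x y \<le> ennreal K * inner_dist V (h x) (h y))"

definition same_germ :: "'a::metric_space \<Rightarrow> 'a set \<Rightarrow> 'a set \<Rightarrow> bool" where
  "same_germ p A B \<longleftrightarrow> (\<exists>\<epsilon>>0. A \<inter> ball p \<epsilon> = B \<inter> ball p \<epsilon>)"

text \<open>A germ of homeomorphism is given by a homeomorphism between representatives
  \<open>U\<close>, \<open>V\<close> of the two set germs; the inner metrics are those of the representatives.\<close>

definition inner_bilipschitz_equivalent_germs ::
    "'a::metric_space set \<Rightarrow> 'a \<Rightarrow> 'b::metric_space set \<Rightarrow> 'b \<Rightarrow> bool" where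
  "inner_bilipschitz_equivalent_germs X p Y q \<longleftrightarrow>
     (\<exists>U V h h'. same_germ p U X \<and> same_germ q V Y \<and> p \<in> U \<and>
        homeomorphism U V h h' \<and> h p = q \<and> inner_bilipschitz_on U V h)"

text \<open>The set \<open>C\<close> represents, at \<open>p\<close>, the germ of a connected component of \<open>X - {p}\<close> together
  with the point \<open>p\<close>: its trace on every small punctured ball is a connected component
  of the trace of \<open>X\<close>. This depends only on the germs of \<open>C\<close> and \<open>X\<close> at \<open>p\<close>.\<close>

definition germ_component :: "'a::metric_space \<Rightarrow> 'a set \<Rightarrow> 'a set \<Rightarrow> bool" where
  "germ_component p X C \<longleftrightarrow>
     p \<in> C \<and>
     (\<exists>\<epsilon>\<^sub>0>0. \<forall>\<epsilon>. 0 < \<epsilon> \<and> \<epsilon> < \<epsilon>\<^sub>0 \<longrightarrow>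
        C \<inter> ball p \<epsilon> - {p} \<in> components (X \<inter> ball p \<epsilon> - {p}))"


section \<open>Mixed Pham-Brieskorn surfaces\<close>

definition mixed_PB_fun ::
    "nat \<Rightarrow> nat \<Rightarrow> nat \<Rightarrow> nat \<Rightarrow> complex \<times> complex \<Rightarrow> complex" where
  "mixed_PB_fun a1 a2 b1 b2 = (\<lambda>(z1, z2).
     z1 ^ (a1 + b1) * cnj z1 ^ b1 + z2 ^ (a2 + b2) * cnj z2 ^ b2)"

definition mixed_PB_surface ::
    "nat \<Rightarrow> nat \<Rightarrow> nat \<Rightarrow> nat \<Rightarrow> (complex \<times> complex) set" where
  "mixed_PB_surface a1 a2 b1 b2 = {z. mixed_PB_fun a1 a2 b1 b2 z = 0}"

definition PB_mu :: "nat \<Rightarrow> nat \<Rightarrow> nat \<Rightarrow> nat \<Rightarrow> real" where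
  "PB_mu a1 a2 b1 b2 = real (a2 + 2 * b2) / real (a1 + 2 * b1)"

definition PB_type1 :: "nat \<Rightarrow> nat \<Rightarrow> nat \<Rightarrow> nat \<Rightarrow> bool" where
  "PB_type1 a1 a2 b1 b2 \<longleftrightarrow> a1 \<ge> 1 \<and> PB_mu a1 a2 b1 b2 > 1"

definition PB_type2 :: "nat \<Rightarrow> nat \<Rightarrow> nat \<Rightarrow> nat \<Rightarrow> bool" where
  "PB_type2 a1 a2 b1 b2 \<longleftrightarrow> a1 \<ge> 1 \<and> PB_mu a1 a2 b1 b2 = 1"

definition PB_type4 :: "nat \<Rightarrow> nat \<Rightarrow> nat \<Rightarrow> nat \<Rightarrow> bool" where
  "PB_type4 a1 a2 b1 b2 \<longleftrightarrow> a1 = 0 \<and> PB_mu a1 a2 b1 b2 < 1"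

definition PB_type5 :: "nat \<Rightarrow> nat \<Rightarrow> nat \<Rightarrow> nat \<Rightarrow> bool" where
  "PB_type5 a1 a2 b1 b2 \<longleftrightarrow> a1 = 0 \<and> PB_mu a1 a2 b1 b2 = 1"

definition PB_admissible :: "nat \<Rightarrow> nat \<Rightarrow> nat \<Rightarrow> nat \<Rightarrow> bool" where
  "PB_admissible a1 a2 b1 b2 \<longleftrightarrow>
     a1 \<le> a2 \<and> a2 \<ge> 1 \<and> (a1 = 0 \<longrightarrow> b1 \<ge> 1) \<and>
     (a1, b1) \<noteq> (1, 0) \<and> (a2, b2) \<noteq> (1, 0) \<and>
     (PB_type1 a1 a2 b1 b2 \<longrightarrow> gcd a1 a2 = 1)"

definition H1_cone :: "(real \<times> real \<times> real) set" where
  "H1_cone = {(x, y, z). x\<^sup>2 + y\<^sup>2 = z\<^sup>2 \<and> z \<ge> 0}"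

end

theory Submission
  imports Defs
begin

text \<open>
  Write \<open>p = a1 + 2 b1\<close>, \<open>q = a2 + 2 b2\<close> and \<open>s\<^sub>i = z\<^sub>i / \<bar>z\<^sub>i\<bar>\<close>. Away from the origin the surface
  is given by the radial equation \<open>\<bar>z\<^sub>1\<bar>\<^sup>p = \<bar>z\<^sub>2\<bar>\<^sup>q\<close> and the angular equation
  \<open>s\<^sub>1\<^bsup>a1\<^esup> = - s\<^sub>2\<^bsup>a2\<^esup>\<close>. Let \<open>d = gcd a1 a2\<close>, \<open>n = a1 / d\<close> and \<open>m = a2 / d\<close>. By the angular equation
  the phase \<open>s\<^sub>1\<^sup>n / s\<^sub>2\<^sup>m\<close> is a \<open>d\<close>-th root of \<open>- 1\<close>, so it is constant on each component. As \<open>m\<close>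
  and \<open>n\<close> are coprime, a level set of the phase on the torus is a single knot, and the component
  is the image of the plane under the injective map that sends \<open>w = t s\<close> with \<open>\<bar>s\<bar> = 1\<close> to
  \<open>(u t\<^sup>\<alpha> s\<^sup>m, v t\<^sup>\<beta> s\<^sup>n)\<close>, where \<open>u\<close> and \<open>v\<close> are unit complex numbers. The exponents satisfy
  \<open>\<alpha> / \<beta> = \<mu>\<close> and are normalised so that the smaller of them is 1
  (lemma \<open>germ_component_knot_chart\<close>).

  In polar coordinates, a coordinate \<open>t\<^sup>\<alpha> s\<^sup>m\<close> pulls the Euclidean metric back to
  \<open>\<alpha>\<^sup>2 t\<^bsup>2 \<alpha> - 2\<^esup> dt\<^sup>2 + m\<^sup>2 t\<^bsup>2 \<alpha>\<^esup> d\<theta>\<^sup>2\<close>. For \<open>\<alpha> \<ge> 1\<close> and \<open>t \<le> 1\<close> it is at most a constant times the flat metric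
  \<open>dt\<^sup>2 + t\<^sup>2 d\<theta>\<^sup>2\<close>, and for \<open>\<alpha> = 1\<close> and \<open>m \<ge> 1\<close> it is at least the flat metric. In the four types
  considered a coordinate with exponent 1 and positive winding number exists: the first one if
  \<open>\<mu> \<le> 1\<close>, as \<open>a2 \<ge> 1\<close>, and the second one if \<open>\<mu> > 1\<close>, as then \<open>a1 \<ge> 1\<close>. Hence the
  inner metric of the component is comparable with the metric of a plane disc, and so is that of the
  circular cone.

  The proof works with distances instead of metric tensors. A chart of the plane is called conical
  if it is injective, Lipschitz near the origin, and does not contract pairs of points with nearby
  directions, or pairs containing the origin, by more than a constant factor. Lemma \<open>conical_chart_inner_dist\<close> derives the
  comparison of inner distances from these properties, and lemma \<open>conical_chart_knot_chart\<close>
  establishes them for the components of the surface.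
\<close>

section \<open>Lengths of curves\<close>

lemma dist_sum_le_curve_length:
  assumes "\<And>i. i \<le> n \<Longrightarrow> t i \<in> {0..1}" and "mono_on {..n} t"
  shows "ennreal (\<Sum>i<n. dist (g (t i)) (g (t (Suc i)))) \<le> curve_length g"
proof -
  have "(t, n) \<in> {(t, n). (\<forall>i\<le>n. t i \<in> {0..1}) \<and> mono_on {..n} t}"
    using assms by auto
  then have "(case (t, n) of (t, n) \<Rightarrow> \<Sum>i<n. ennreal (dist (g (t i)) (g (t (Suc i))))) \<le> curve_length g"
    unfolding curve_length_def by (rule SUP_upper)
  then show ?thesis by (simp add: sum_ennreal)
qed

lemma dist_via_le_curve_length:
  assumes "s \<in> {0..1}"
  shows "ennreal (dist (g 0) (g s) + dist (g s) (g 1)) \<le> curve_length g"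
proof -
  define t where "t = (\<lambda>i::nat. if i = 0 then 0 else if i = 1 then s else (1::real))"
  have "ennreal (\<Sum>i<2. dist (g (t i)) (g (t (Suc i)))) \<le> curve_length g"
    by (rule dist_sum_le_curve_length)
       (use assms in \<open>auto simp: t_def mono_on_def\<close>)
  then show ?thesis by (simp add: t_def eval_nat_numeral)
qed

lemma curve_length_lipschitz_image_linepath:
  fixes F :: "'a::real_normed_vector \<Rightarrow> 'b::metric_space"
  assumes L: "L-lipschitz_on (closed_segment w w') F"
  shows "curve_length (F \<circ> linepath w w') \<le> ennreal (L * dist w w')"
  unfolding curve_length_def
proof (rule SUP_least)
  fix tn :: "(nat \<Rightarrow> real) \<times> nat"
  assume tn: "tn \<in> {(t, n). (\<forall>i\<le>n. t i \<in> {0..1}) \<and> mono_on {..n} t}"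
  obtain t n where tn_eq: "tn = (t, n)" by (cases tn)
  have t: "\<forall>i\<le>n. 0 \<le> t i \<and> t i \<le> 1" and mono: "mono_on {..n} t"
    using tn by (auto simp: tn_eq)
  have L0: "0 \<le> L" using L by (rule lipschitz_on_nonneg)
  have step: "dist (F (linepath w w' (t i))) (F (linepath w w' (t (Suc i))))
                \<le> L * dist w w' * (t (Suc i) - t i)" if "i < n" for i
  proof -
    have le: "t i \<le> t (Suc i)"
      using mono that by (auto simp: mono_on_def)
    have "dist (F (linepath w w' (t i))) (F (linepath w w' (t (Suc i))))
            \<le> L * dist (linepath w w' (t i)) (linepath w w' (t (Suc i)))"
      by (rule lipschitz_onD[OF L]) (use t that in \<open>auto intro!: linepath_in_path\<close>)
    also have "dist (linepath w w' (t i)) (linepath w w' (t (Suc i))) = (t (Suc i) - t i) * dist w w'"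
    proof -
      have "linepath w w' (t i) - linepath w w' (t (Suc i)) = (t (Suc i) - t i) *\<^sub>R (w - w')"
        by (simp add: linepath_def algebra_simps)
      then show ?thesis using le by (simp add: dist_norm)
    qed
    finally show ?thesis by (simp add: mult_ac)
  qed
  have "(\<Sum>i<n. dist (F (linepath w w' (t i))) (F (linepath w w' (t (Suc i)))))
          \<le> (\<Sum>i<n. L * dist w w' * (t (Suc i) - t i))"
    by (rule sum_mono) (use step in auto)
  also have "\<dots> = L * dist w w' * (t n - t 0)"
    by (simp add: sum_distrib_left[symmetric] sum_lessThan_telescope)
  also have "\<dots> \<le> L * dist w w' * 1"
  proof (rule mult_left_mono)
    have "t n \<le> 1" "0 \<le> t 0" using t by auto
    then show "t n - t 0 \<le> 1" by linarith
  qed (use L0 in simp)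
  finally show "(case tn of (t, n) \<Rightarrow>
      \<Sum>i<n. ennreal (dist ((F \<circ> linepath w w') (t i)) ((F \<circ> linepath w w') (t (Suc i)))))
      \<le> ennreal (L * dist w w')"
    by (simp add: tn_eq sum_ennreal ennreal_leI)
qed

section \<open>Conical charts\<close>

text \<open>The inequality bounding \<open>dist w w'\<close> is demanded only for points whose directions nearly agree, and
  against the apex. For arbitrary pairs it would be too much to ask: a parametrisation of the surface
  that winds several times around the origin brings distant rays of the plane close together in
  the ambient space. Since \<^term>\<open>sgn (0 :: complex) = 0\<close>, the apex has no direction and is treated
  separately.\<close>

definition conical_chart :: "(complex \<Rightarrow> 'a::metric_space) \<Rightarrow> bool" where
  "conical_chart F \<longleftrightarrow> inj F \<and> (\<exists>L. L-lipschitz_on (cball 0 1) F) \<and>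
     (\<exists>K>0. \<exists>\<eta>>0. \<forall>w w'. w' = 0 \<or> dist (sgn w) (sgn w') < \<eta> \<longrightarrow>
        dist w w' \<le> K * dist (F w) (F w'))"

text \<open>Expansion of pairs with nearby directions is enough to bound lengths from below. A curve that
  meets the apex is at least as long as the two radii to its end points together, up to the
  factor \<open>K\<close>. A curve that avoids the apex has a uniformly continuous direction, so it can be cut
  into finitely many pieces whose end points have nearby directions.\<close>

lemma conical_chart_curve_length:
  fixes F :: "complex \<Rightarrow> 'a::metric_space" and \<gamma> :: "real \<Rightarrow> complex"
  assumes K: "K > 0" and \<eta>: "\<eta> > 0"
    and expand: "\<And>w w'. w' = 0 \<or> dist (sgn w) (sgn w') < \<eta> \<Longrightarrow> dist w w' \<le> K * dist (F w) (F w')"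
    and \<gamma>: "continuous_on {0..1} \<gamma>"
  shows "ennreal (dist (\<gamma> 0) (\<gamma> 1)) \<le> ennreal K * curve_length (F \<circ> \<gamma>)"
proof (cases "\<exists>s\<in>{0..1}. \<gamma> s = 0")
  case True
  then obtain s where s: "s \<in> {0..1}" "\<gamma> s = 0" by auto
  have "dist (\<gamma> 0) (\<gamma> 1) \<le> dist (\<gamma> 0) (\<gamma> s) + dist (\<gamma> 1) (\<gamma> s)"
    by (rule dist_triangle2)
  also have "\<dots> \<le> K * dist (F (\<gamma> 0)) (F (\<gamma> s)) + K * dist (F (\<gamma> 1)) (F (\<gamma> s))"
    by (intro add_mono expand) (use s in auto)
  also have "\<dots> = K * (dist ((F \<circ> \<gamma>) 0) ((F \<circ> \<gamma>) s) + dist ((F \<circ> \<gamma>) s) ((F \<circ> \<gamma>) 1))"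
    by (simp add: algebra_simps dist_commute)
  finally have "ennreal (dist (\<gamma> 0) (\<gamma> 1))
      \<le> ennreal K * ennreal (dist ((F \<circ> \<gamma>) 0) ((F \<circ> \<gamma>) s) + dist ((F \<circ> \<gamma>) s) ((F \<circ> \<gamma>) 1))"
    using K by (subst ennreal_mult[symmetric]) (auto intro: ennreal_leI)
  also have "\<dots> \<le> ennreal K * curve_length (F \<circ> \<gamma>)"
    by (intro mult_left_mono dist_via_le_curve_length s) auto
  finally show ?thesis .
next
  case False
  \<comment> \<open>The direction of \<open>\<gamma>\<close> is uniformly continuous, so it varies by less than \<open>\<eta>\<close> on each
    interval of a sufficiently fine equidistant subdivision.\<close>
  have "uniformly_continuous_on {0..1} (\<lambda>s. sgn (\<gamma> s))"
    by (intro compact_uniformly_continuous continuous_intros \<gamma>) (use False in auto)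
  then obtain \<delta> where "\<delta> > 0" and \<delta>: "\<And>s s'. s \<in> {0..1} \<Longrightarrow> s' \<in> {0..1} \<Longrightarrow> dist s' s < \<delta> \<Longrightarrow>
      dist (sgn (\<gamma> s')) (sgn (\<gamma> s)) < \<eta>"
    unfolding uniformly_continuous_on_def using \<eta> by metis
  obtain N where N: "inverse (real (Suc N)) < \<delta>"
    using reals_Archimedean[OF \<open>\<delta> > 0\<close>] by blast
  define n where "n = Suc N"
  define t where "t = (\<lambda>i. real i / real n)"
  have n: "n > 0" "1 / real n < \<delta>" using N by (auto simp: n_def inverse_eq_divide)
  have t01: "t i \<in> {0..1}" if "i \<le> n" for i
    using that n by (auto simp: t_def field_simps)
  have step: "dist (t i) (t (Suc i)) < \<delta>" for i
    using n by (simp add: t_def dist_real_def diff_divide_distrib[symmetric])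
  have "dist (\<gamma> (t 0)) (\<gamma> (t m)) \<le> (\<Sum>i<m. dist (\<gamma> (t i)) (\<gamma> (t (Suc i))))" for m
  proof (induction m)
    case (Suc m)
    then show ?case using dist_triangle[of "\<gamma> (t 0)" "\<gamma> (t (Suc m))" "\<gamma> (t m)"] by simp
  qed simp
  then have "dist (\<gamma> 0) (\<gamma> 1) \<le> (\<Sum>i<n. dist (\<gamma> (t i)) (\<gamma> (t (Suc i))))"
    using n by (metis t_def of_nat_0 div_0 divide_self of_nat_0_eq_iff less_numeral_extra(3))
  also have "\<dots> \<le> (\<Sum>i<n. K * dist (F (\<gamma> (t i))) (F (\<gamma> (t (Suc i)))))"
    by (intro sum_mono expand disjI2 \<delta>) (use t01 step in auto)
  also have "\<dots> = K * (\<Sum>i<n. dist ((F \<circ> \<gamma>) (t i)) ((F \<circ> \<gamma>) (t (Suc i))))"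
    by (simp add: sum_distrib_left)
  finally have "ennreal (dist (\<gamma> 0) (\<gamma> 1))
      \<le> ennreal K * ennreal (\<Sum>i<n. dist ((F \<circ> \<gamma>) (t i)) ((F \<circ> \<gamma>) (t (Suc i))))"
    using K by (simp add: ennreal_mult[symmetric] ennreal_leI sum_nonneg)
  also have "\<dots> \<le> ennreal K * curve_length (F \<circ> \<gamma>)"
    by (intro mult_left_mono dist_sum_le_curve_length t01)
       (auto simp: mono_on_def t_def divide_right_mono)
  finally show ?thesis .
qed

lemma conical_chart_homeomorphism:
  fixes F :: "complex \<Rightarrow> 'a::metric_space"
  assumes "conical_chart F"
  obtains F' where "homeomorphism (ball 0 1) (F ` ball 0 1) F F'"
proof -
  obtain L where L: "L-lipschitz_on (cball 0 1) F" and inj: "inj F"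
    using assms by (auto simp: conical_chart_def)
  have "\<exists>F'. homeomorphism (cball 0 1) (F ` cball 0 1) F F'"
    by (intro homeomorphism_compact lipschitz_on_continuous_on[OF L] inj_on_subset[OF inj]) auto
  then obtain F' where "homeomorphism (cball 0 1) (F ` cball 0 1) F F'" ..
  from homeomorphism_of_subsets[OF this ball_subset_cball subset_refl refl] show thesis
    by (rule that)
qed

text \<open>A conical chart carries the Euclidean metric of the disc to the inner metric of its image, up to
  constants. From above, because the disc is convex and the image of a segment is a competitor for
  the infimum; from below, because every competitor lifts to a curve in the disc through the
  continuous inverse of the chart.\<close>

lemma conical_chart_inner_dist:
  fixes F :: "complex \<Rightarrow> 'a::metric_space"
  assumes "conical_chart F"
  obtains K where "K \<ge> 0"
    "\<And>w w'. w \<in> ball 0 1 \<Longrightarrow> w' \<in> ball 0 1 \<Longrightarrow>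
       inner_dist (F ` ball 0 1) (F w) (F w') \<le> ennreal (K * dist w w')"
    "\<And>w w'. w \<in> ball 0 1 \<Longrightarrow> w' \<in> ball 0 1 \<Longrightarrow>
       ennreal (dist w w') \<le> ennreal K * inner_dist (F ` ball 0 1) (F w) (F w')"
proof -
  obtain L where L: "L-lipschitz_on (cball 0 1) F"
    using assms by (auto simp: conical_chart_def)
  obtain K \<eta> where K: "K > 0" and \<eta>: "\<eta> > 0"
    and expand: "\<And>w w'. w' = 0 \<or> dist (sgn w) (sgn w') < \<eta> \<Longrightarrow> dist w w' \<le> K * dist (F w) (F w')"
    using assms unfolding conical_chart_def by metis
  obtain F' where F': "homeomorphism (ball 0 1) (F ` ball 0 1) F F'"
    using conical_chart_homeomorphism[OF assms] .
  have upper: "inner_dist (F ` ball 0 1) (F w) (F w') \<le> ennreal (L * dist w w')"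
    if w: "w \<in> ball 0 1" "w' \<in> ball 0 1" for w w'
  proof -
    have seg: "closed_segment w w' \<subseteq> ball 0 1"
      using w by (simp add: closed_segment_subset)
    then have seg': "closed_segment w w' \<subseteq> cball 0 1"
      using ball_subset_cball by blast
    let ?g = "F \<circ> linepath w w'"
    have len: "curve_length ?g \<le> ennreal (L * dist w w')"
      by (intro curve_length_lipschitz_image_linepath lipschitz_on_subset[OF L seg'])
    have "path ?g"
      by (intro path_continuous_image path_linepath)
         (simp add: continuous_on_subset[OF lipschitz_on_continuous_on[OF L]] seg')
    moreover have "curve_length ?g < top"
      using len ennreal_less_top order.strict_trans1 by blast
    ultimately have "?g \<in> {g. rectifiable g \<and> path_image g \<subseteq> F ` ball 0 1 \<and>
        pathstart g = F w \<and> pathfinish g = F w'}"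
      using seg by (auto simp: rectifiable_def path_image_compose pathstart_compose pathfinish_compose)
    then have "inner_dist (F ` ball 0 1) (F w) (F w') \<le> curve_length ?g"
      unfolding inner_dist_def by (rule INF_lower)
    with len show ?thesis by (rule order_trans[rotated])
  qed
  have lower: "ennreal (dist w w') \<le> ennreal K * curve_length g"
    if w: "w \<in> ball 0 1" "w' \<in> ball 0 1"
      and g: "path g" "path_image g \<subseteq> F ` ball 0 1" "pathstart g = F w" "pathfinish g = F w'"
    for w w' g
  proof -
    have "continuous_on {0..1} (F' \<circ> g)"
      using g by (intro continuous_on_compose continuous_on_subset[OF homeomorphism_cont2[OF F']])
        (auto simp: path_def path_image_def)
    from conical_chart_curve_length[OF K \<eta> expand this]
    have "ennreal (dist (F' (g 0)) (F' (g 1))) \<le> ennreal K * curve_length (F \<circ> (F' \<circ> g))"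
      by (auto simp: o_def)
    moreover have "curve_length (F \<circ> (F' \<circ> g)) = curve_length g"
    proof -
      have Fg: "F (F' (g s)) = g s" if "s \<in> {0..1}" for s
        by (rule homeomorphism_apply2[OF F']) (use g that in \<open>auto simp: path_image_def\<close>)
      show ?thesis unfolding curve_length_def
        by (intro SUP_cong refl) (auto intro!: sum.cong simp: Fg)
    qed
    moreover have "F' (g 0) = w" "F' (g 1) = w'"
      using g w homeomorphism_apply1[OF F'] by (auto simp: pathstart_def pathfinish_def)
    ultimately show ?thesis by simp
  qed
  have lower': "ennreal (dist w w') \<le> ennreal K * inner_dist (F ` ball 0 1) (F w) (F w')"
    if w: "w \<in> ball 0 1" "w' \<in> ball 0 1" for w w'
  proof -
    have "ennreal (dist w w' / K) \<le> inner_dist (F ` ball 0 1) (F w) (F w')"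
      unfolding inner_dist_def
    proof (rule INF_greatest)
      fix g assume "g \<in> {g. rectifiable g \<and> path_image g \<subseteq> F ` ball 0 1 \<and>
        pathstart g = F w \<and> pathfinish g = F w'}"
      then have *: "ennreal (dist w w') \<le> ennreal K * curve_length g" and "curve_length g < top"
        using lower[OF w] by (auto simp: rectifiable_def)
      then obtain l where l: "curve_length g = ennreal l" "l \<ge> 0"
        by (cases "curve_length g") auto
      from * have "dist w w' \<le> K * l"
        using K l by (simp add: ennreal_mult[symmetric])
      then show "ennreal (dist w w' / K) \<le> curve_length g"
        using K l by (auto intro!: ennreal_leI simp: field_simps)
    qed
    then have "ennreal K * ennreal (dist w w' / K) \<le> ennreal K * inner_dist (F ` ball 0 1) (F w) (F w')"
      by (rule mult_left_mono) simp
    then show ?thesis using K by (simp add: ennreal_mult[symmetric])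
  qed
  show thesis
  proof (rule that[of "max L K"])
    fix w w' :: complex assume w: "w \<in> ball 0 1" "w' \<in> ball 0 1"
    show "inner_dist (F ` ball 0 1) (F w) (F w') \<le> ennreal (max L K * dist w w')"
      by (rule order_trans[OF upper[OF w]]) (auto intro!: ennreal_leI mult_right_mono)
    show "ennreal (dist w w') \<le> ennreal (max L K) * inner_dist (F ` ball 0 1) (F w) (F w')"
      by (rule order_trans[OF lower'[OF w]]) (auto intro!: mult_right_mono ennreal_leI)
  qed (use K in auto)
qed

text \<open>Expansion against the apex keeps the image of the complement of the disc away from \<open>F 0\<close>.\<close>

lemma conical_chart_same_germ:
  fixes F :: "complex \<Rightarrow> 'a::metric_space"
  assumes "conical_chart F"
  shows "same_germ (F 0) (F ` ball 0 1) (range F)"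
proof -
  obtain K where K: "K > 0" and expand: "\<And>w. dist w 0 \<le> K * dist (F w) (F 0)"
    using assms unfolding conical_chart_def by metis
  have "w \<in> ball 0 1" if "F w \<in> ball (F 0) (1 / K)" for w
  proof -
    have "K * dist (F w) (F 0) < 1" using that K by (simp add: field_simps dist_commute)
    then show ?thesis using expand[of w] by simp
  qed
  then show ?thesis using K unfolding same_germ_def
    by (intro exI[of _ "1 / K"]) auto
qed

lemma same_germ_trans: "same_germ p A B \<Longrightarrow> same_germ p B C \<Longrightarrow> same_germ p A C"
  unfolding same_germ_def
proof (elim exE conjE)
  fix d e :: real assume "d > 0" "e > 0" "A \<inter> ball p d = B \<inter> ball p d" "B \<inter> ball p e = C \<inter> ball p e"
  then show "\<exists>\<epsilon>>0. A \<inter> ball p \<epsilon> = C \<inter> ball p \<epsilon>"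
    by (intro exI[of _ "min d e"]) (auto simp: set_eq_iff)
qed

text \<open>Both inner metrics are comparable with the metric of one and the same disc, hence with each
  other along the homeomorphism \<open>G \<circ> F\<inverse>\<close>.\<close>

lemma conical_charts_inner_bilipschitz_equivalent:
  fixes F :: "complex \<Rightarrow> 'a::metric_space" and G :: "complex \<Rightarrow> 'b::metric_space"
  assumes F: "conical_chart F" and G: "conical_chart G"
    and X: "same_germ (F 0) (range F) X" and Y: "same_germ (G 0) (range G) Y"
  shows "inner_bilipschitz_equivalent_germs X (F 0) Y (G 0)"
proof -
  let ?U = "F ` ball 0 1" and ?V = "G ` ball 0 1"
  obtain F' where F': "homeomorphism (ball 0 1) ?U F F'"
    using conical_chart_homeomorphism[OF F] .
  obtain G' where G': "homeomorphism (ball 0 1) ?V G G'"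
    using conical_chart_homeomorphism[OF G] .
  have hom: "homeomorphism ?U ?V (G \<circ> F') (F \<circ> G')"
    by (rule homeomorphism_compose[OF homeomorphism_symD[OF F'] G'])
  have F'F: "F' (F w) = w" if "w \<in> ball 0 1" for w
    by (rule homeomorphism_apply1[OF F' that])
  obtain K where K: "K \<ge> 0"
    and KU: "\<And>w w'. w \<in> ball 0 1 \<Longrightarrow> w' \<in> ball 0 1 \<Longrightarrow>
       inner_dist ?U (F w) (F w') \<le> ennreal (K * dist w w')"
    and KLo: "\<And>w w'. w \<in> ball 0 1 \<Longrightarrow> w' \<in> ball 0 1 \<Longrightarrow>
       ennreal (dist w w') \<le> ennreal K * inner_dist ?U (F w) (F w')"
    using conical_chart_inner_dist[OF F] by metis
  obtain M where M: "M \<ge> 0"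
    and MU: "\<And>w w'. w \<in> ball 0 1 \<Longrightarrow> w' \<in> ball 0 1 \<Longrightarrow>
       inner_dist ?V (G w) (G w') \<le> ennreal (M * dist w w')"
    and MLo: "\<And>w w'. w \<in> ball 0 1 \<Longrightarrow> w' \<in> ball 0 1 \<Longrightarrow>
       ennreal (dist w w') \<le> ennreal M * inner_dist ?V (G w) (G w')"
    using conical_chart_inner_dist[OF G] by metis
  have "inner_bilipschitz_on ?U ?V (G \<circ> F')"
    unfolding inner_bilipschitz_on_def
  proof (intro exI[of _ "max 1 (K * M)"] conjI ballI)
    have le: "ennreal (K * M) * c \<le> ennreal (max 1 (K * M)) * c" for c
      by (intro mult_right_mono ennreal_leI) auto
    fix x y assume "x \<in> ?U" "y \<in> ?U"
    then obtain w w' where w: "w \<in> ball 0 1" "w' \<in> ball 0 1" and xy: "x = F w" "y = F w'" by auto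
    have "inner_dist ?V (G w) (G w') \<le> ennreal M * ennreal (dist w w')"
      using MU[OF w] M by (simp add: ennreal_mult)
    also have "\<dots> \<le> ennreal M * (ennreal K * inner_dist ?U (F w) (F w'))"
      by (intro mult_left_mono KLo w) auto
    also have "\<dots> = ennreal (K * M) * inner_dist ?U (F w) (F w')"
      using K M by (simp add: ennreal_mult mult_ac)
    finally show "inner_dist ?V ((G \<circ> F') x) ((G \<circ> F') y) \<le> ennreal (max 1 (K * M)) * inner_dist ?U x y"
      using le[of "inner_dist ?U (F w) (F w')"] by (simp add: xy F'F[OF w(1)] F'F[OF w(2)])
    have "inner_dist ?U (F w) (F w') \<le> ennreal K * ennreal (dist w w')"
      using KU[OF w] K by (simp add: ennreal_mult)
    also have "\<dots> \<le> ennreal K * (ennreal M * inner_dist ?V (G w) (G w'))"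
      by (intro mult_left_mono MLo w) auto
    also have "\<dots> = ennreal (K * M) * inner_dist ?V (G w) (G w')"
      using K M by (simp add: ennreal_mult mult_ac)
    finally show "inner_dist ?U x y \<le> ennreal (max 1 (K * M)) * inner_dist ?V ((G \<circ> F') x) ((G \<circ> F') y)"
      using le[of "inner_dist ?V (G w) (G w')"] by (simp add: xy F'F[OF w(1)] F'F[OF w(2)])
  qed auto
  moreover have "same_germ (F 0) ?U X" "same_germ (G 0) ?V Y"
    using same_germ_trans conical_chart_same_germ F G X Y by blast+
  moreover have "(G \<circ> F') (F 0) = G 0" by (simp add: F'F)
  ultimately show ?thesis
    unfolding inner_bilipschitz_equivalent_germs_def using hom
    by (intro exI[of _ ?U] exI[of _ ?V] exI[of _ "G \<circ> F'"] exI[of _ "F \<circ> G'"]) auto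
qed

section \<open>The cone over a circle\<close>

definition H1_chart :: "complex \<Rightarrow> real \<times> real \<times> real" where
  "H1_chart w = (Re w, Im w, norm w)"

lemma range_H1_chart: "range H1_chart = H1_cone"
proof (intro set_eqI iffI)
  fix v assume "v \<in> H1_cone"
  then obtain x y z where v: "v = (x, y, z)" "x\<^sup>2 + y\<^sup>2 = z\<^sup>2" "z \<ge> 0"
    by (auto simp: H1_cone_def)
  then have "v = H1_chart (Complex x y)"
    by (simp add: H1_chart_def cmod_def)
  then show "v \<in> range H1_chart" by blast
qed (auto simp: H1_chart_def H1_cone_def cmod_def)

lemma dist_le_dist_H1_chart: "dist w w' \<le> dist (H1_chart w) (H1_chart w')"
  by (simp add: H1_chart_def dist_norm norm_Pair cmod_def)

lemma conical_chart_H1: "conical_chart H1_chart"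
  unfolding conical_chart_def
proof (intro conjI)
  show "inj H1_chart" by (auto simp: inj_def H1_chart_def complex_eq_iff)
  have "2-lipschitz_on (cball 0 1) H1_chart"
  proof (rule lipschitz_onI)
    fix w w' :: complex
    have "dist (H1_chart w) (H1_chart w') = sqrt ((dist w w')\<^sup>2 + (norm w - norm w')\<^sup>2)"
      by (simp add: H1_chart_def dist_norm norm_Pair cmod_def)
    also have "\<dots> \<le> \<bar>dist w w'\<bar> + \<bar>norm w - norm w'\<bar>"
      by (rule sqrt_sum_squares_le_sum_abs)
    also have "\<dots> \<le> dist w w' + dist w w'"
      using norm_triangle_ineq3[of w w'] by (simp add: dist_norm)
    finally show "dist (H1_chart w) (H1_chart w') \<le> 2 * dist w w'" by simp
  qed simp
  then show "\<exists>L. L-lipschitz_on (cball 0 1) H1_chart" ..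
  show "\<exists>K>0. \<exists>\<eta>>0. \<forall>w w'. w' = 0 \<or> dist (sgn w) (sgn w') < \<eta> \<longrightarrow>
      dist w w' \<le> K * dist (H1_chart w) (H1_chart w')"
    by (intro exI[of _ 1] conjI) (simp_all add: dist_le_dist_H1_chart)
qed

section \<open>Winding maps of the plane\<close>

text \<open>For \<open>w = t s\<close> with \<open>t > 0\<close> and \<open>\<bar>s\<bar> = 1\<close> this is \<open>t\<^sup>\<alpha> s\<^sup>m\<close>, a map that winds \<open>m\<close> times
  around the origin. It vanishes at the origin, because \<open>0 powr \<alpha> = 0\<close>.\<close>

definition winding_power :: "real \<Rightarrow> nat \<Rightarrow> complex \<Rightarrow> complex" where
  "winding_power \<alpha> m w = of_real (norm w powr \<alpha>) * sgn w ^ m"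

lemma norm_winding_power: "norm (winding_power \<alpha> m w) = norm w powr \<alpha>"
  by (cases "w = 0") (simp_all add: winding_power_def norm_mult norm_power norm_sgn)

lemma sgn_power: "sgn ((z :: complex) ^ m) = sgn z ^ m"
  by (induction m) (simp_all add: sgn_mult)

lemma sgn_winding_power: "w \<noteq> 0 \<Longrightarrow> sgn (winding_power \<alpha> m w) = sgn w ^ m"
  by (simp add: winding_power_def sgn_mult sgn_of_real sgn_power)

lemma powr_diff_le:
  fixes x y \<alpha> :: real
  assumes "0 \<le> x" "x \<le> y" "y \<le> 1" "\<alpha> \<ge> 1"
  shows "y powr \<alpha> - x powr \<alpha> \<le> \<alpha> * (y - x)"
proof (cases "x = 0")
  case True
  have "y powr \<alpha> \<le> y powr 1"
    using assms by (intro powr_mono') auto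
  also have "\<dots> \<le> \<alpha> * y"
    using assms mult_right_mono[of 1 \<alpha> y] by simp
  finally show ?thesis using True by simp
next
  case False
  show ?thesis
  proof (cases "x < y")
    case True
    have "\<exists>z. x < z \<and> z < y \<and> y powr \<alpha> - x powr \<alpha> = (y - x) * (\<alpha> * z powr (\<alpha> - 1))"
      by (rule MVT2[OF True]) (use False assms in \<open>auto intro!: derivative_eq_intros simp: powr_diff\<close>)
    then obtain z where z: "x < z" "z < y"
      "y powr \<alpha> - x powr \<alpha> = (y - x) * (\<alpha> * z powr (\<alpha> - 1))" by blast
    have "z powr (\<alpha> - 1) \<le> 1"
      using z assms by (intro powr_le1) auto
    then have "(y - x) * (\<alpha> * z powr (\<alpha> - 1)) \<le> (y - x) * (\<alpha> * 1)"
      using True assms by (intro mult_left_mono) auto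
    then show ?thesis using z by (simp add: mult_ac)
  qed (use assms in auto)
qed

text \<open>Changing the radius \<open>r'\<close> of the second point to \<open>r\<close> moves it by \<open>\<bar>r - r'\<bar>\<close>, which is at most the
  distance of the two points.\<close>

lemma radius_mult_dist_directions_le:
  fixes x y :: complex
  assumes "norm x = 1" "norm y = 1" "r \<ge> 0" "r' \<ge> 0"
  shows "r * dist x y \<le> 2 * dist (of_real r * x) (of_real r' * y)"
proof -
  let ?d = "dist (of_real r * x) (of_real r' * y)"
  have "\<bar>r' - r\<bar> \<le> ?d"
    using norm_triangle_ineq3[of "of_real r * x" "of_real r' * y"] assms
    by (simp add: dist_norm norm_mult abs_minus_commute)
  have "r * dist x y = norm (of_real r * x - of_real r * y)"
    using assms by (simp add: dist_norm norm_mult right_diff_distrib[symmetric])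
  also have "\<dots> = norm ((of_real r * x - of_real r' * y) + of_real (r' - r) * y)"
    by (simp add: algebra_simps)
  also have "\<dots> \<le> ?d + norm (of_real (r' - r) * y)"
    by (metis dist_norm norm_triangle_ineq)
  also have "norm (of_real (r' - r) * y) = \<bar>r' - r\<bar>"
    using assms by (simp add: norm_mult del: of_real_diff)
  finally show ?thesis using \<open>\<bar>r' - r\<bar> \<le> ?d\<close> by linarith
qed

lemma of_real_norm_mult_sgn: "of_real (norm w) * sgn w = (w :: complex)"
  by (cases "w = 0") (simp_all add: sgn_eq)

text \<open>The radius \<open>t \<mapsto> t\<^sup>\<alpha>\<close> has slope at most \<open>\<alpha>\<close> on the unit interval. The direction of \<open>w\<close> varies
  with a rate of order \<open>1 / t\<close>, which the factor \<open>t\<^sup>\<alpha> \<le> t\<close> compensates. Both estimates need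
  \<open>\<alpha> \<ge> 1\<close>. The direction is compared at the smaller of the two radii, so that one of the points
  may be the origin.\<close>

lemma winding_power_lipschitz:
  assumes \<alpha>: "\<alpha> \<ge> 1"
  shows "(\<alpha> + 2 * real m)-lipschitz_on (cball 0 1) (winding_power \<alpha> m)"
proof (rule lipschitz_onI)
  have main: "dist (winding_power \<alpha> m w) (winding_power \<alpha> m w') \<le> (\<alpha> + 2 * real m) * dist w w'"
    if w: "norm w' \<le> 1" "norm w \<le> norm w'" for w w'
  proof -
    define r r' s s' where rs: "r = norm w" "r' = norm w'" "s = sgn w" "s' = sgn w'"
    have rr: "0 \<le> r" "r \<le> r'" "r' \<le> 1" using w by (auto simp: rs)
    have s1: "norm s \<le> 1" "norm s' \<le> 1" by (auto simp: rs norm_sgn)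
    have "winding_power \<alpha> m w - winding_power \<alpha> m w'
        = of_real (r powr \<alpha>) * (s ^ m - s' ^ m) - of_real (r' powr \<alpha> - r powr \<alpha>) * s' ^ m"
      by (simp add: winding_power_def rs algebra_simps)
    then have "dist (winding_power \<alpha> m w) (winding_power \<alpha> m w')
        \<le> r powr \<alpha> * norm (s ^ m - s' ^ m) + \<bar>r' powr \<alpha> - r powr \<alpha>\<bar> * norm (s' ^ m)"
      using norm_triangle_ineq4[of "of_real (r powr \<alpha>) * (s ^ m - s' ^ m)"
          "of_real (r' powr \<alpha> - r powr \<alpha>) * s' ^ m"]
      by (simp add: dist_norm norm_mult del: of_real_diff)
    also have "\<dots> \<le> r * (real m * dist s s') + \<alpha> * (r' - r)"
    proof (rule add_mono)
      have "r powr \<alpha> \<le> r powr 1"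
        using rr \<alpha> by (intro powr_mono') auto
      then show "r powr \<alpha> * norm (s ^ m - s' ^ m) \<le> r * (real m * dist s s')"
        using rr norm_power_diff[OF s1] by (intro mult_mono) (auto simp: dist_norm)
      have "norm (s' ^ m) \<le> 1" using s1 by (simp add: norm_power power_le_one)
      moreover have "0 \<le> r' powr \<alpha> - r powr \<alpha>" using rr \<alpha> by (simp add: powr_mono2)
      ultimately have "\<bar>r' powr \<alpha> - r powr \<alpha>\<bar> * norm (s' ^ m) \<le> (r' powr \<alpha> - r powr \<alpha>) * 1"
        by (intro mult_mono) auto
      also have "\<dots> \<le> \<alpha> * (r' - r)" using powr_diff_le[OF rr \<alpha>] by simp
      finally show "\<bar>r' powr \<alpha> - r powr \<alpha>\<bar> * norm (s' ^ m) \<le> \<alpha> * (r' - r)" .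
    qed
    also have "\<dots> \<le> real m * (2 * dist w w') + \<alpha> * dist w w'"
    proof (rule add_mono)
      have "r * dist s s' \<le> 2 * dist w w'"
      proof (cases "w = 0")
        case False
        then have "w' \<noteq> 0" using w by auto
        then show ?thesis
          using radius_mult_dist_directions_le[of s s' r r'] False rr
          by (simp add: rs norm_sgn of_real_norm_mult_sgn)
      qed (simp add: rs)
      then show "r * (real m * dist s s') \<le> real m * (2 * dist w w')"
        using mult_left_mono[of "r * dist s s'" "2 * dist w w'" "real m"] by (simp add: mult_ac)
      have "r' - r \<le> dist w w'"
        unfolding rs by (metis dist_commute dist_norm norm_triangle_ineq2)
      then show "\<alpha> * (r' - r) \<le> \<alpha> * dist w w'"
        using \<alpha> by (intro mult_left_mono) auto
    qed
    finally show ?thesis by (simp add: algebra_simps)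
  qed
  fix w w' :: complex assume "w \<in> cball 0 1" "w' \<in> cball 0 1"
  then show "dist (winding_power \<alpha> m w) (winding_power \<alpha> m w') \<le> (\<alpha> + 2 * real m) * dist w w'"
    using main[of w' w] main[of w w'] by (cases "norm w \<le> norm w'") (auto simp: dist_commute)
qed (use \<alpha> in simp)

lemma unit_dist_le_power_dist:
  fixes x y :: complex
  assumes x: "norm x = 1" and y: "norm y = 1" and n: "n \<ge> 1" and close: "dist x y \<le> 1 / (2 * real n)"
  shows "dist x y \<le> 2 * dist (x ^ n) (y ^ n)"
proof -
  \<comment> \<open>In \<open>x ^ n - y ^ n = (x - y) * S\<close> every summand of the cofactor \<open>S\<close> is within \<open>1 / 2\<close> of
    \<open>x ^ (n - 1)\<close>, hence \<open>\<bar>S\<bar> \<ge> n - n / 2 \<ge> 1 / 2\<close>.\<close>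
  define S where "S = (\<Sum>i<n. y ^ (n - Suc i) * x ^ i)"
  have summand: "norm (y ^ (n - Suc i) * x ^ i - x ^ (n - 1)) \<le> 1 / 2" if i: "i < n" for i
  proof -
    have "x ^ (n - 1) = x ^ (n - Suc i) * x ^ i"
      using i by (simp add: power_add[symmetric])
    then have "norm (y ^ (n - Suc i) * x ^ i - x ^ (n - 1)) = norm (y ^ (n - Suc i) - x ^ (n - Suc i))"
      by (simp add: left_diff_distrib[symmetric] norm_mult norm_power x)
    also have "\<dots> \<le> real (n - Suc i) * norm (y - x)"
      by (rule norm_power_diff) (simp_all add: x y)
    also have "\<dots> \<le> real n * (1 / (2 * real n))"
      using close by (intro mult_mono) (auto simp: dist_norm norm_minus_commute)
    also have "\<dots> = 1 / 2" using n by simp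
    finally show ?thesis .
  qed
  have "S - of_nat n * x ^ (n - 1) = (\<Sum>i<n. y ^ (n - Suc i) * x ^ i - x ^ (n - 1))"
    by (simp add: S_def sum_subtractf)
  then have "norm (S - of_nat n * x ^ (n - 1)) \<le> (\<Sum>i<n. 1 / 2)"
    by (simp only:) (rule sum_norm_le, use summand in auto)
  moreover have "norm (of_nat n * x ^ (n - 1)) = real n"
    by (simp add: norm_mult norm_power x)
  ultimately have "real n - real n / 2 \<le> norm S"
    using norm_triangle_ineq2[of "of_nat n * x ^ (n - 1)" S] by (simp add: norm_minus_commute)
  then have "1 / 2 \<le> norm S" using n by simp
  have "x ^ n - y ^ n = (x - y) * S"
    unfolding S_def by (rule power_diff_sumr2)
  then have "dist (x ^ n) (y ^ n) = dist x y * norm S"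
    by (simp add: dist_norm norm_mult)
  moreover have "dist x y * (1 / 2) \<le> dist x y * norm S"
    using \<open>1 / 2 \<le> norm S\<close> by (intro mult_left_mono) auto
  ultimately show ?thesis by simp
qed

text \<open>A winding map with radial exponent 1 preserves radii, and a positive winding number cannot
  contract the distance of nearby directions much. The constant splits as \<open>4 + 1\<close>: a factor 2 for
  passing from \<open>s\<^sup>n\<close> back to \<open>s\<close> and a factor 2 for comparing points of different radii, and then
  the difference of the radii.\<close>

lemma winding_power_expand:
  assumes n: "n \<ge> 1" and w: "w' = 0 \<or> dist (sgn w) (sgn w') < 1 / (2 * real n)"
  shows "dist w w' \<le> 5 * dist (winding_power 1 n w) (winding_power 1 n w')"
proof (cases "w = 0 \<or> w' = 0")
  case True
  have *: "dist v 0 \<le> 5 * dist (winding_power 1 n v) (winding_power 1 n 0)" for v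
    by (simp add: winding_power_def norm_mult norm_power norm_sgn)
  from True show ?thesis
    using *[of w] *[of w'] by (auto simp: dist_commute)
next
  case False
  define r r' s s' where rs: "r = norm w" "r' = norm w'" "s = sgn w" "s' = sgn w'"
  have s: "norm s = 1" "norm s' = 1" using False by (auto simp: rs norm_sgn)
  let ?D = "dist (winding_power 1 n w) (winding_power 1 n w')"
  have r: "\<bar>r - r'\<bar> \<le> ?D"
    using norm_triangle_ineq3[of "winding_power 1 n w" "winding_power 1 n w'"]
    by (simp add: dist_norm norm_winding_power rs)
  have "dist s s' \<le> 2 * dist (s ^ n) (s' ^ n)"
    by (rule unit_dist_le_power_dist) (use s n w False in \<open>auto simp: rs\<close>)
  then have "r * dist s s' \<le> 2 * (r * dist (s ^ n) (s' ^ n))"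
    using mult_left_mono[of "dist s s'" "2 * dist (s ^ n) (s' ^ n)" r] by (simp add: rs mult_ac)
  also have "r * dist (s ^ n) (s' ^ n) \<le> 2 * ?D"
    using radius_mult_dist_directions_le[of "s ^ n" "s' ^ n" r r'] s
    by (simp add: norm_power winding_power_def rs)
  finally have "r * dist s s' \<le> 4 * ?D" by simp
  moreover have "dist w w' \<le> r * dist s s' + \<bar>r - r'\<bar>"
  proof -
    have "w - w' = of_real r * (s - s') + of_real (r - r') * s'"
      using of_real_norm_mult_sgn[of w] of_real_norm_mult_sgn[of w'] by (simp add: rs algebra_simps)
    then have "dist w w' \<le> norm (of_real r * (s - s')) + norm (of_real (r - r') * s')"
      unfolding dist_norm by (metis norm_triangle_ineq)
    also have "\<dots> = r * dist s s' + \<bar>r - r'\<bar>"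
      using s by (simp add: norm_mult dist_norm rs del: of_real_diff)
    finally show ?thesis .
  qed
  ultimately show ?thesis using r by simp
qed

lemma eq_if_coprime_powers_eq:
  fixes x y :: complex
  assumes "x \<noteq> 0" "y \<noteq> 0" "coprime m n" "m > 0" "x ^ m = y ^ m" "x ^ n = y ^ n"
  shows "x = y"
proof -
  obtain i j where ij: "m * i = n * j + 1"
    using bezout_nat[of m n] assms by auto
  have "x ^ (n * j) * x = x ^ (m * i)" by (simp add: ij)
  also have "\<dots> = y ^ (n * j) * y"
    unfolding power_mult assms(5) by (simp add: ij flip: power_mult)
  also have "y ^ (n * j) = x ^ (n * j)" unfolding power_mult assms(6) ..
  finally show ?thesis using assms by simp
qed

text \<open>On the torus knot \<open>x ^ n = y ^ m\<close> the parameter of \<open>(x, y)\<close> is the monomial in \<open>x\<close> and \<open>y\<close> given by Bezout coefficients.\<close>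

lemma torus_knot_parametrization:
  fixes x y :: complex
  assumes "norm x = 1" "norm y = 1" "coprime m n" "m > 0" "x ^ n = y ^ m"
  obtains s where "norm s = 1" "s ^ m = x" "s ^ n = y"
proof -
  obtain i j where ij: "m * i = n * j + 1"
    using bezout_nat[of m n] assms by auto
  have nz: "x \<noteq> 0" "y \<noteq> 0" using assms by auto
  show thesis
  proof (rule that[of "x ^ i / y ^ j"])
    show "norm (x ^ i / y ^ j) = 1" using assms by (simp add: norm_divide norm_power)
    have "(x ^ i / y ^ j) ^ m = x ^ (m * i) / (y ^ m) ^ j"
      by (simp add: power_divide power_mult[symmetric] mult.commute)
    also have "(y ^ m) ^ j = x ^ (n * j)" by (simp add: assms(5)[symmetric] power_mult)
    finally show "(x ^ i / y ^ j) ^ m = x" using nz by (simp add: ij)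
    have "(x ^ i / y ^ j) ^ n = (x ^ n) ^ i / y ^ (n * j)"
      by (simp add: power_divide power_mult[symmetric] mult.commute)
    also have "(x ^ n) ^ i = y ^ (m * i)" by (simp add: assms(5) power_mult)
    finally show "(x ^ i / y ^ j) ^ n = y" using nz by (simp add: ij)
  qed
qed

text \<open>For fixed \<open>\<bar>w\<bar>\<close> the chart runs through the torus knot \<open>s \<mapsto> (u s\<^sup>m, v s\<^sup>n)\<close>, with the two
  circles of the torus scaled to radii \<open>\<bar>w\<bar>\<^sup>\<alpha>\<close> and \<open>\<bar>w\<bar>\<^sup>\<beta>\<close>.\<close>

definition knot_chart ::
    "real \<Rightarrow> real \<Rightarrow> nat \<Rightarrow> nat \<Rightarrow> complex \<Rightarrow> complex \<Rightarrow> complex \<Rightarrow> complex \<times> complex" where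
  "knot_chart \<alpha> \<beta> m n u v w = (u * winding_power \<alpha> m w, v * winding_power \<beta> n w)"

lemma knot_chart_0 [simp]: "knot_chart \<alpha> \<beta> m n u v 0 = 0"
  by (simp add: knot_chart_def winding_power_def zero_prod_def)

text \<open>Injectivity comes from both coordinates: coprime powers determine the direction. Expansion comes
  from a single coordinate, one whose radial exponent is 1 and whose winding number is positive.
  The other coordinate may shrink faster, which costs nothing, because adding it only increases
  distances.\<close>

lemma conical_chart_knot_chart:
  assumes uv: "norm u = 1" "norm v = 1" and exps: "\<alpha> \<ge> 1" "\<beta> \<ge> 1"
    and coprime: "coprime m n" "m > 0" and base: "\<alpha> = 1 \<or> \<beta> = 1 \<and> n > 0"
  shows "conical_chart (knot_chart \<alpha> \<beta> m n u v)"
  unfolding conical_chart_def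
proof (intro conjI)
  let ?F = "knot_chart \<alpha> \<beta> m n u v"
  have dist_mult: "dist (c * x) (c * y) = dist x y" if "norm c = 1" for c x y :: complex
    using that by (simp add: dist_norm norm_mult right_diff_distrib[symmetric])
  show "inj ?F"
  proof (rule injI)
    fix w w' assume "?F w = ?F w'"
    then have eq: "winding_power \<alpha> m w = winding_power \<alpha> m w'" "winding_power \<beta> n w = winding_power \<beta> n w'"
      using uv by (auto simp: knot_chart_def)
    have norms: "norm w = norm w'"
      using arg_cong[OF eq(1), of norm] exps unfolding norm_winding_power
      using powr_less_mono2[of \<alpha> "norm w" "norm w'"] powr_less_mono2[of \<alpha> "norm w'" "norm w"]
      by (cases "norm w" "norm w'" rule: linorder_cases) auto
    show "w = w'"
    proof (cases "w = 0")
      case False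
      then have "w' \<noteq> 0" using norms by auto
      with False have "sgn w ^ m = sgn w' ^ m" "sgn w ^ n = sgn w' ^ n"
        using arg_cong[OF eq(1), of sgn] arg_cong[OF eq(2), of sgn] by (simp_all add: sgn_winding_power)
      then have "sgn w = sgn w'"
        using eq_if_coprime_powers_eq[of "sgn w" "sgn w'"] coprime False \<open>w' \<noteq> 0\<close>
        by (simp add: sgn_zero_iff)
      then show ?thesis
        using norms by (metis of_real_norm_mult_sgn)
    qed (use norms in simp)
  qed
  have "((\<alpha> + 2 * real m) + (\<beta> + 2 * real n))-lipschitz_on (cball 0 1) ?F"
  proof (rule lipschitz_onI)
    fix w w' :: complex assume w: "w \<in> cball 0 1" "w' \<in> cball 0 1"
    have "dist (?F w) (?F w') \<le> dist (winding_power \<alpha> m w) (winding_power \<alpha> m w')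
        + dist (winding_power \<beta> n w) (winding_power \<beta> n w')"
      unfolding knot_chart_def dist_Pair_Pair
      by (rule order_trans[OF sqrt_sum_squares_le_sum]) (simp_all add: dist_mult uv)
    also have "\<dots> \<le> (\<alpha> + 2 * real m) * dist w w' + (\<beta> + 2 * real n) * dist w w'"
      by (intro add_mono lipschitz_onD[OF winding_power_lipschitz] w exps)
    finally show "dist (?F w) (?F w') \<le> ((\<alpha> + 2 * real m) + (\<beta> + 2 * real n)) * dist w w'"
      by (simp add: algebra_simps)
  qed (use exps in simp)
  then show "\<exists>L. L-lipschitz_on (cball 0 1) ?F" ..
  have fst: "dist (winding_power \<alpha> m w) (winding_power \<alpha> m w') \<le> dist (?F w) (?F w')" for w w'
    using dist_fst_le[of "?F w" "?F w'"] by (simp add: knot_chart_def dist_mult uv)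
  have snd: "dist (winding_power \<beta> n w) (winding_power \<beta> n w') \<le> dist (?F w) (?F w')" for w w'
    using dist_snd_le[of "?F w" "?F w'"] by (simp add: knot_chart_def dist_mult uv)
  obtain k :: nat where k: "k \<ge> 1" and expand: "\<And>w w'. w' = 0 \<or> dist (sgn w) (sgn w') < 1 / (2 * real k) \<Longrightarrow>
      dist w w' \<le> 5 * dist (?F w) (?F w')"
  proof (cases "\<alpha> = 1")
    case True
    show thesis
    proof (rule that[of m])
      fix w w' :: complex assume "w' = 0 \<or> dist (sgn w) (sgn w') < 1 / (2 * real m)"
      then show "dist w w' \<le> 5 * dist (?F w) (?F w')"
        using winding_power_expand[of m w' w] fst[of w w'] True coprime by auto
    qed (use coprime in auto)
  next
    case False
    show thesis
    proof (rule that[of n])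
      fix w w' :: complex assume "w' = 0 \<or> dist (sgn w) (sgn w') < 1 / (2 * real n)"
      then show "dist w w' \<le> 5 * dist (?F w) (?F w')"
        using winding_power_expand[of n w' w] snd[of w w'] False base by auto
    qed (use False base in auto)
  qed
  show "\<exists>K>0. \<exists>\<eta>>0. \<forall>w w'. w' = 0 \<or> dist (sgn w) (sgn w') < \<eta> \<longrightarrow>
        dist w w' \<le> K * dist (?F w) (?F w')"
    by (intro exI[of _ 5] conjI exI[of _ "1 / (2 * real k)"] allI impI expand) (use k in auto)
qed

section \<open>Components of mixed Pham-Brieskorn surfaces\<close>

lemma powr_power_eq: "(x powr c) ^ k = x powr (c * real k)" if "x > 0" for x c :: real
  using that by (simp add: powr_realpow[symmetric] powr_powr)

lemma mixed_monomial_polar: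
  fixes z :: complex
  shows "z ^ (a + b) * cnj z ^ b = of_real (norm z ^ (a + 2 * b)) * sgn z ^ a"
proof -
  have "z ^ (a + b) * cnj z ^ b = (z * cnj z) ^ b * z ^ a"
    by (simp add: power_add power_mult_distrib mult_ac)
  also have "z * cnj z = of_real ((norm z)\<^sup>2)"
    by (rule complex_norm_square[symmetric])
  also have "z ^ a = of_real (norm z ^ a) * sgn z ^ a"
    using of_real_norm_mult_sgn[of z] by (metis of_real_power power_mult_distrib)
  finally show ?thesis
    by (simp add: power_add mult_ac flip: power_mult)
qed

lemma mixed_PB_surface_polar:
  assumes "a1 + 2 * b1 > 0" "a2 + 2 * b2 > 0"
  shows "(z1, z2) \<in> mixed_PB_surface a1 a2 b1 b2 - {0} \<longleftrightarrow> z1 \<noteq> 0 \<and> z2 \<noteq> 0 \<and>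
    norm z1 ^ (a1 + 2 * b1) = norm z2 ^ (a2 + 2 * b2) \<and> sgn z1 ^ a1 = - (sgn z2 ^ a2)"
    (is "?X \<longleftrightarrow> ?P")
proof -
  let ?p = "a1 + 2 * b1" and ?q = "a2 + 2 * b2"
  have f: "mixed_PB_fun a1 a2 b1 b2 (z1, z2)
      = of_real (norm z1 ^ ?p) * sgn z1 ^ a1 + of_real (norm z2 ^ ?q) * sgn z2 ^ a2"
    by (simp add: mixed_PB_fun_def mixed_monomial_polar)
  show ?thesis
  proof
    assume ?X
    then have nz: "z1 \<noteq> 0 \<or> z2 \<noteq> 0"
      and "of_real (norm z1 ^ ?p) * sgn z1 ^ a1 = - (of_real (norm z2 ^ ?q) * sgn z2 ^ a2)"
      unfolding mixed_PB_surface_def f[symmetric]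
      by (auto simp: zero_prod_def f eq_neg_iff_add_eq_0)
    then have eq: "of_real (norm z1 ^ ?p) * sgn z1 ^ a1 = of_real (norm z2 ^ ?q) * - (sgn z2 ^ a2)"
      by simp
    have norms: "norm z1 ^ ?p * norm (sgn z1) ^ a1 = norm z2 ^ ?q * norm (sgn z2) ^ a2"
      using arg_cong[OF eq, of norm] by (simp add: norm_mult norm_power)
    have "z1 = 0 \<longleftrightarrow> z2 = 0"
      using norms assms by (auto simp: norm_sgn power_0_left split: if_splits)
    with nz have "z1 \<noteq> 0" "z2 \<noteq> 0" by auto
    moreover from this have "norm z1 ^ ?p = norm z2 ^ ?q"
      using norms by (simp add: norm_sgn)
    moreover have "sgn z1 ^ a1 = - (sgn z2 ^ a2)"
    proof -
      have "of_real (norm z1 ^ ?p) \<noteq> (0 :: complex)" using \<open>z1 \<noteq> 0\<close> by simp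
      then show ?thesis
        using eq unfolding \<open>norm z1 ^ ?p = norm z2 ^ ?q\<close> by (metis mult_left_cancel)
    qed
    ultimately show ?P by blast
  next
    assume ?P
    then show ?X by (auto simp: mixed_PB_surface_def f zero_prod_def)
  qed
qed

text \<open>On a surface with angular exponents \<open>a1 = d n\<close> and \<open>a2 = d m\<close> this is a \<open>d\<close>-th root of \<open>- 1\<close>, hence
  locally constant away from the origin; it tells the components apart.\<close>

definition knot_phase :: "nat \<Rightarrow> nat \<Rightarrow> complex \<times> complex \<Rightarrow> complex" where
  "knot_phase m n z = sgn (fst z) ^ n / sgn (snd z) ^ m"

text \<open>The number \<open>d\<close> stands for the greatest common divisor of \<open>a1\<close> and \<open>a2\<close>. The case \<open>n = 0\<close> is
  \<open>a1 = 0\<close>, where then \<open>m = 1\<close>: the knots are circles on which the second coordinate has a constant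
  direction.\<close>

context
  fixes a1 a2 b1 b2 m n d :: nat and \<alpha> \<beta> :: real
  assumes degrees: "a1 + 2 * b1 > 0" "a2 + 2 * b2 > 0"
    and angular: "a1 = d * n" "a2 = d * m" "coprime m n" "m > 0" "d > 0"
    and radial: "\<alpha> \<ge> 1" "\<beta> \<ge> 1" "\<alpha> * real (a1 + 2 * b1) = \<beta> * real (a2 + 2 * b2)"
begin

text \<open>A torus knot through a point of the torus is the level set of the phase through that point, and
  the radial equation of the surface says that the two radii are \<open>t\<^sup>\<alpha>\<close> and \<open>t\<^sup>\<beta>\<close> for a
  common \<open>t > 0\<close>.\<close>

lemma knot_chart_image:
  assumes z0: "z0 \<in> mixed_PB_surface a1 a2 b1 b2 - {0}"
  shows "knot_chart \<alpha> \<beta> m n (sgn (fst z0)) (sgn (snd z0)) ` (- {0}) =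
    {z \<in> mixed_PB_surface a1 a2 b1 b2 - {0}. knot_phase m n z = knot_phase m n z0}"
proof -
  obtain x0 y0 where z0_eq: "z0 = (x0, y0)" by (cases z0)
  define u v where uv: "u = sgn x0" "v = sgn y0"
  have nz0: "x0 \<noteq> 0" "y0 \<noteq> 0" and phase0: "u ^ a1 = - (v ^ a2)"
    using z0 unfolding z0_eq mixed_PB_surface_polar[OF degrees] by (auto simp: uv)
  have n1: "norm u = 1" "norm v = 1" using nz0 by (auto simp: uv norm_sgn)
  then have unz: "u \<noteq> 0" "v \<noteq> 0" by auto
  have sgn_uv: "sgn u = u" "sgn v = v" by (simp_all add: uv)
  show ?thesis
  proof (intro set_eqI iffI)
    fix z assume "z \<in> knot_chart \<alpha> \<beta> m n (sgn (fst z0)) (sgn (snd z0)) ` (- {0})"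
    then obtain w where w: "w \<noteq> 0" and z: "z = (u * winding_power \<alpha> m w, v * winding_power \<beta> n w)"
      by (auto simp: knot_chart_def z0_eq uv)
    have sgns: "sgn (u * winding_power \<alpha> m w) = u * sgn w ^ m"
        "sgn (v * winding_power \<beta> n w) = v * sgn w ^ n"
      using w by (simp_all add: sgn_mult sgn_winding_power sgn_uv)
    have norms: "norm (u * winding_power \<alpha> m w) = norm w powr \<alpha>"
        "norm (v * winding_power \<beta> n w) = norm w powr \<beta>"
      using n1 by (simp_all add: norm_mult norm_winding_power)
    have pw: "(norm w powr \<alpha>) ^ (a1 + 2 * b1) = (norm w powr \<beta>) ^ (a2 + 2 * b2)"
    proof -
      have "norm w > 0" using w by simp
      then show ?thesis by (simp only: powr_power_eq radial(3))
    qed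
    have ne: "u * winding_power \<alpha> m w \<noteq> 0" "v * winding_power \<beta> n w \<noteq> 0"
      using w unz by (auto simp: winding_power_def sgn_zero_iff)
    have ang: "(u * sgn w ^ m) ^ a1 = - ((v * sgn w ^ n) ^ a2)"
      using phase0 angular by (simp add: power_mult_distrib power_mult[symmetric] mult_ac)
    have "z \<in> mixed_PB_surface a1 a2 b1 b2 - {0}"
      unfolding z mixed_PB_surface_polar[OF degrees] norms sgns using ne pw ang by simp
    moreover have "knot_phase m n z = knot_phase m n z0"
      using w unz by (simp add: knot_phase_def z z0_eq sgns power_mult_distrib uv[symmetric]
          power_mult[symmetric] mult.commute sgn_zero_iff)
    ultimately show "z \<in> {z \<in> mixed_PB_surface a1 a2 b1 b2 - {0}. knot_phase m n z = knot_phase m n z0}"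
      by simp
  next
    fix z assume z: "z \<in> {z \<in> mixed_PB_surface a1 a2 b1 b2 - {0}. knot_phase m n z = knot_phase m n z0}"
    obtain x y where z_eq: "z = (x, y)" by (cases z)
    have nz: "x \<noteq> 0" "y \<noteq> 0" and norms: "norm x ^ (a1 + 2 * b1) = norm y ^ (a2 + 2 * b2)"
      using z mixed_PB_surface_polar[OF degrees, of x y] by (auto simp: z_eq)
    have "sgn x ^ n / sgn y ^ m = u ^ n / v ^ m"
      using z by (simp add: z_eq knot_phase_def z0_eq uv)
    then have "(sgn x / u) ^ n = (sgn y / v) ^ m"
      using nz unz by (simp add: power_divide frac_eq_eq sgn_zero_iff mult.commute)
    then obtain s where s: "norm s = 1" "s ^ m = sgn x / u" "s ^ n = sgn y / v"
      using torus_knot_parametrization[of "sgn x / u" "sgn y / v" m n] angular nz n1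
      by (auto simp: norm_divide norm_sgn)
    define t where "t = norm x powr (1 / \<alpha>)"
    have t: "t > 0" using nz by (simp add: t_def)
    have tx: "t powr \<alpha> = norm x"
      using radial nz by (simp add: t_def powr_powr)
    have "(t powr \<beta>) ^ (a2 + 2 * b2) = (t powr \<alpha>) ^ (a1 + 2 * b1)"
      using t radial(3) by (simp only: powr_power_eq)
    also have "\<dots> = norm y ^ (a2 + 2 * b2)" using norms tx by simp
    finally have ty: "t powr \<beta> = norm y"
      by (rule power_eq_imp_eq_base) (use degrees in auto)
    define w where "w = of_real t * s"
    have w: "norm w = t" "sgn w = s" "w \<noteq> 0"
      using t s(1) by (auto simp: w_def norm_mult sgn_mult sgn_of_real sgn_eq)
    have "knot_chart \<alpha> \<beta> m n u v w = z"
      using unz by (simp add: knot_chart_def winding_power_def w tx ty s z_eq of_real_norm_mult_sgn)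
    then show "z \<in> knot_chart \<alpha> \<beta> m n (sgn (fst z0)) (sgn (snd z0)) ` (- {0})"
      using w by (auto simp: z0_eq uv)
  qed
qed

lemma knot_phase_power:
  assumes "z \<in> mixed_PB_surface a1 a2 b1 b2 - {0}"
  shows "knot_phase m n z ^ d = - 1"
proof -
  obtain x y where z: "z = (x, y)" by (cases z)
  have "y \<noteq> 0" "sgn x ^ a1 = - (sgn y ^ a2)"
    using assms mixed_PB_surface_polar[OF degrees, of x y] by (auto simp: z)
  then show ?thesis
    using angular by (simp add: knot_phase_def z power_divide power_mult[symmetric] mult.commute sgn_zero_iff)
qed

lemma knot_phase_constant_on_connected:
  assumes "connected D" and D: "D \<subseteq> mixed_PB_surface a1 a2 b1 b2 - {0}"
  shows "knot_phase m n constant_on D"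
proof (rule continuous_finite_range_constant[OF assms(1)])
  have nz: "fst z \<noteq> 0 \<and> snd z \<noteq> 0" if "z \<in> D" for z
    using that D mixed_PB_surface_polar[OF degrees, of "fst z" "snd z"] by auto
  then show "continuous_on D (knot_phase m n)"
    unfolding knot_phase_def[abs_def] by (intro continuous_intros) (auto simp: sgn_zero_iff)
  have "knot_phase m n ` D \<subseteq> {c. c ^ d = - 1}"
    using knot_phase_power D by auto
  then show "finite (knot_phase m n ` D)"
    by (rule finite_subset) (use angular in auto)
qed

text \<open>The norm of the chart is an increasing function of the radius of the argument, so the
  part of the image in a ball is the image of an interval of radii times the circle of
  directions.\<close>

lemma connected_knot_chart_small_image:
  assumes uv: "norm u = 1" "norm v = 1"
  shows "connected (knot_chart \<alpha> \<beta> m n u v ` (- {0}) \<inter> ball 0 \<epsilon>)"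
proof -
  define N where "N = (\<lambda>t. sqrt ((t powr \<alpha>)\<^sup>2 + (t powr \<beta>)\<^sup>2))"
  define T where "T = {t. t > 0 \<and> N t < \<epsilon>}"
  define P where "P = (\<lambda>(t, s). (u * (of_real (t powr \<alpha>) * s ^ m), v * (of_real (t powr \<beta>) * s ^ n)))"
  have norm_chart: "norm (knot_chart \<alpha> \<beta> m n u v w) = N (norm w)" for w
    using uv by (simp add: knot_chart_def norm_Pair norm_mult norm_winding_power N_def)
  have N_mono: "N t \<le> N t'" if "0 < t" "t \<le> t'" for t t'
    using that radial unfolding N_def
    by (intro real_sqrt_le_mono add_mono power_mono powr_mono2) auto
  have "is_interval T"
    unfolding is_interval_1 T_def using N_mono by (smt (verit) mem_Collect_eq)
  then have "connected (T \<times> sphere (0::complex) 1)"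
    by (intro connected_Times is_interval_connected connected_sphere) auto
  moreover have "continuous_on (T \<times> sphere 0 1) P"
    unfolding P_def case_prod_unfold by (intro continuous_intros) (auto simp: T_def)
  ultimately have "connected (P ` (T \<times> sphere 0 1))"
    by (intro connected_continuous_image)
  also have "P ` (T \<times> sphere 0 1) = knot_chart \<alpha> \<beta> m n u v ` (- {0}) \<inter> ball 0 \<epsilon>"
  proof (intro set_eqI iffI)
    fix z assume "z \<in> P ` (T \<times> sphere 0 1)"
    then obtain t s where ts: "t > 0" "N t < \<epsilon>" "norm s = 1" and z: "z = P (t, s)"
      by (auto simp: T_def)
    define w where "w = of_real t * s"
    have w: "norm w = t" "sgn w = s" "w \<noteq> 0"
      using ts by (auto simp: w_def norm_mult sgn_mult sgn_of_real sgn_eq)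
    have "z = knot_chart \<alpha> \<beta> m n u v w"
      by (simp add: z P_def knot_chart_def winding_power_def w)
    moreover have "norm (knot_chart \<alpha> \<beta> m n u v w) < \<epsilon>"
      using norm_chart[of w] ts w by simp
    ultimately show "z \<in> knot_chart \<alpha> \<beta> m n u v ` (- {0}) \<inter> ball 0 \<epsilon>"
      using w by auto
  next
    fix z assume "z \<in> knot_chart \<alpha> \<beta> m n u v ` (- {0}) \<inter> ball 0 \<epsilon>"
    then obtain w where w: "w \<noteq> 0" "norm (knot_chart \<alpha> \<beta> m n u v w) < \<epsilon>" "z = knot_chart \<alpha> \<beta> m n u v w"
      by auto
    have "z = P (norm w, sgn w)"
      by (simp add: w P_def knot_chart_def winding_power_def)
    moreover have "(norm w, sgn w) \<in> T \<times> sphere 0 1"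
      using w norm_chart[of w] by (auto simp: T_def norm_sgn)
    ultimately show "z \<in> P ` (T \<times> sphere 0 1)" by blast
  qed
  finally show ?thesis .
qed

text \<open>The component is contained in a level set of the phase because it is connected, and it contains
  the trace of that level set on the ball because this trace is connected as well.\<close>

lemma component_eq_knot_chart_image:
  assumes D: "D \<in> components (mixed_PB_surface a1 a2 b1 b2 \<inter> ball 0 \<epsilon> - {0})" and z0: "z0 \<in> D"
  shows "D = knot_chart \<alpha> \<beta> m n (sgn (fst z0)) (sgn (snd z0)) ` (- {0}) \<inter> ball 0 \<epsilon>"
    (is "_ = ?Y \<inter> _")
proof -
  have DX: "D \<subseteq> mixed_PB_surface a1 a2 b1 b2 \<inter> ball 0 \<epsilon> - {0}"
    using D by (rule in_components_subset)
  then have z0X: "z0 \<in> mixed_PB_surface a1 a2 b1 b2 - {0}" "z0 \<in> ball 0 \<epsilon>"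
    using z0 by auto
  note Y = knot_chart_image[OF z0X(1)]
  have "knot_phase m n constant_on D"
    by (rule knot_phase_constant_on_connected[OF in_components_connected[OF D]]) (use DX in auto)
  then have "knot_phase m n z = knot_phase m n z0" if "z \<in> D" for z
    using that z0 unfolding constant_on_def by metis
  then have sub: "D \<subseteq> ?Y \<inter> ball 0 \<epsilon>"
    unfolding Y using DX by auto
  have nz: "fst z0 \<noteq> 0" "snd z0 \<noteq> 0"
    using z0X mixed_PB_surface_polar[OF degrees, of "fst z0" "snd z0"] by auto
  have "?Y \<inter> ball 0 \<epsilon> \<subseteq> D"
  proof (rule components_maximal[OF D])
    show "connected (?Y \<inter> ball 0 \<epsilon>)"
      by (rule connected_knot_chart_small_image) (use nz in \<open>auto simp: norm_sgn\<close>)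
    show "?Y \<inter> ball 0 \<epsilon> \<subseteq> mixed_PB_surface a1 a2 b1 b2 \<inter> ball 0 \<epsilon> - {0}"
      unfolding Y by auto
    show "D \<inter> (?Y \<inter> ball 0 \<epsilon>) \<noteq> {}" using sub z0 by auto
  qed
  with sub show ?thesis by (rule subset_antisym)
qed

text \<open>The directions \<open>u\<close> and \<open>v\<close> are those of the coordinates of any point of the component near the
  origin.\<close>

lemma germ_component_knot_chart:
  assumes C: "germ_component 0 (mixed_PB_surface a1 a2 b1 b2) C"
  obtains u v where "norm u = 1" "norm v = 1" "same_germ 0 (range (knot_chart \<alpha> \<beta> m n u v)) C"
proof -
  let ?X = "mixed_PB_surface a1 a2 b1 b2"
  obtain e where "0 \<in> C" "e > 0"
    and comp: "\<And>\<epsilon>. 0 < \<epsilon> \<Longrightarrow> \<epsilon> < e \<Longrightarrow> C \<inter> ball 0 \<epsilon> - {0} \<in> components (?X \<inter> ball 0 \<epsilon> - {0})"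
    using C unfolding germ_component_def by blast
  define \<epsilon> where "\<epsilon> = e / 2"
  have \<epsilon>: "0 < \<epsilon>" "\<epsilon> < e" using \<open>e > 0\<close> by (auto simp: \<epsilon>_def)
  let ?D = "C \<inter> ball 0 \<epsilon> - {0}"
  have "?D \<noteq> {}" using comp[OF \<epsilon>] by (rule in_components_nonempty)
  then obtain z0 where z0: "z0 \<in> ?D" by blast
  have z0X: "z0 \<in> ?X - {0}" using in_components_subset[OF comp[OF \<epsilon>]] z0 by auto
  let ?F = "knot_chart \<alpha> \<beta> m n (sgn (fst z0)) (sgn (snd z0))"
  have D: "?D = ?F ` (- {0}) \<inter> ball 0 \<epsilon>"
    by (rule component_eq_knot_chart_image[OF comp[OF \<epsilon>] z0])
  have "insert 0 (- {0}) = (UNIV :: complex set)" by auto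
  then have "range ?F = insert 0 (?F ` (- {0}))"
    by (metis image_insert knot_chart_0)
  moreover have "C \<inter> ball 0 \<epsilon> = insert 0 ?D"
    using \<open>0 \<in> C\<close> \<epsilon> by auto
  ultimately have "range ?F \<inter> ball 0 \<epsilon> = C \<inter> ball 0 \<epsilon>"
    using D \<epsilon> by simp
  then have germ: "same_germ 0 (range ?F) C"
    using \<epsilon> unfolding same_germ_def by blast
  have "fst z0 \<noteq> 0" "snd z0 \<noteq> 0"
    using z0X mixed_PB_surface_polar[OF degrees, of "fst z0" "snd z0"] by auto
  then show thesis
    using that[OF _ _ germ] by (simp add: norm_sgn)
qed

end

theorem proposition6p4:
  fixes a1 a2 b1 b2 :: nat and C :: "(complex \<times> complex) set"
  assumes "PB_admissible a1 a2 b1 b2"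
    and "PB_type1 a1 a2 b1 b2 \<or> PB_type2 a1 a2 b1 b2 \<or>
         PB_type4 a1 a2 b1 b2 \<or> PB_type5 a1 a2 b1 b2"
    and "germ_component 0 (mixed_PB_surface a1 a2 b1 b2) C"
  shows "inner_bilipschitz_equivalent_germs C 0 H1_cone 0"
proof -
  define p q where pq: "p = a1 + 2 * b1" "q = a2 + 2 * b2"
  define d where "d = gcd a1 a2"
  define \<mu> where "\<mu> = PB_mu a1 a2 b1 b2"
  have a2: "a2 > 0" and p: "p > 0" and q: "q > 0"
    using assms(1) by (auto simp: PB_admissible_def pq)
  have \<mu>: "\<mu> = real q / real p" by (simp add: \<mu>_def PB_mu_def pq)
  have \<mu>0: "\<mu> > 0" using p q by (simp add: \<mu>)
  have "d > 0" using a2 by (simp add: d_def)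
  then obtain n m where nm: "a1 = n * d" "a2 = m * d" "coprime n m"
    unfolding d_def using gcd_coprime_exists[of a1 a2] by auto
  have nm': "a1 = d * n" "a2 = d * m" "coprime m n" "m > 0"
    using nm a2 by (auto simp: coprime_commute intro: Nat.gr0I)
  \<comment> \<open>The coordinate of exponent 1 is the first one if \<open>\<mu> \<le> 1\<close>, and the second one, which winds
    \<open>n\<close> times, if \<open>\<mu> \<ge> 1\<close>.\<close>
  have base: "\<mu> \<le> 1 \<or> n > 0"
    using assms(2) nm' unfolding PB_type1_def PB_type2_def PB_type4_def PB_type5_def \<mu>_def by auto
  \<comment> \<open>The exponents are normalised so that their quotient is \<open>\<mu>\<close> and the smaller one is 1.\<close>
  define \<alpha> \<beta> where ab: "\<alpha> = max 1 \<mu>" "\<beta> = max 1 (1 / \<mu>)"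
  have radial: "\<alpha> \<ge> 1" "\<beta> \<ge> 1" "\<alpha> * real p = \<beta> * real q"
    using \<mu>0 p q by (auto simp: ab \<mu> max_def field_simps)
  obtain u v where uv: "norm u = 1" "norm v = 1"
    and germ: "same_germ 0 (range (knot_chart \<alpha> \<beta> m n u v)) C"
    using germ_component_knot_chart[OF p[unfolded pq] q[unfolded pq] nm' \<open>d > 0\<close>
        radial[unfolded pq] assms(3)] .
  have "conical_chart (knot_chart \<alpha> \<beta> m n u v)"
    by (rule conical_chart_knot_chart) (use uv radial nm' base \<mu>0 in \<open>auto simp: ab max_def\<close>)
  moreover have "H1_chart 0 = 0" by (simp add: H1_chart_def zero_prod_def)
  moreover have "same_germ 0 (range H1_chart) H1_cone"
    unfolding range_H1_chart same_germ_def by (intro exI[of _ 1]) simp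
  ultimately show ?thesis
    using conical_charts_inner_bilipschitz_equivalent[of _ H1_chart C H1_cone, OF _ conical_chart_H1] germ
    by (metis knot_chart_0)
qed

end
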